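(* For $n\ge k$ and $1\le i\le n$ let $Q_{n,i}(\lambda)=\Phi(a_{n,i}(\lambda-b_{n,i}))$ be normal ogive item response functions with real parameters $a_{n,i}>0$ and $b_{n,i}$, with latent trait $\Lambda\sim N(0,1)$. Let $$P_{n,i}(\theta)=Q_{n,i}(\Phi^{-1}(\theta))=\Phi\big(a_{n,i}[\Phi^{-1}(\theta)-b_{n,i}]\big)$$ be the corresponding transformed item response functions with latent trait $\Theta=\Phi(\Lambda)\sim U(0,1)$. (i) If $|a_{n,i}|\neq 1$ or $b_{n,i}\neq 0$, then each of the limits $\lim_{\theta\downarrow 0}P'_{n,i}(\theta)$ and $\lim_{\theta\uparrow 1}P'_{n,i}(\theta)$ is either $0$ or $+\infty$. (ii) Assume there exist constants $C_a,C_b>0$ independent of $(n,i)$ such that $a_{n,i}\in[1/C_a,C_a]$ and $|b_{n,i}|\in[1/C_b,C_b]$ for all $(n,i)$. Then $\{P_{n,i}\}$ satisfies Conditions 3 and 4 (stated in the context), the latter with $\kappa_{n,i}=0$ and $\gamma_{n,i}=1$.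
   Context: $\Phi$ is the cumulative distribution function of $N(0,1)$ and $\Phi^{-1}:(0,1)\to\mathbb{R}$ its inverse; the values $P_{n,i}(0),P_{n,i}(1)$ are understood as the limits of $P_{n,i}(\theta)$ as $\theta\downarrow0$, $\theta\uparrow1$. The indices range over a triangular array $n\ge k$, $1\le i\le n$, for a fixed integer $k\ge1$. Condition 3. For each $(n,i)$ the derivative $P'_{n,i}$ exists and is continuous on $(0,1)$. For all $0<\alpha<\beta<1$ there exist constants $m_{\alpha\beta},M_{\alpha\beta}$, not depending on $(n,i)$, such that $0<m_{\alpha\beta}<P'_{n,i}(\theta)<M_{\alpha\beta}<\infty$ for all $\theta\in[\alpha,\beta]$ and all $(n,i)$. Condition 4. For each $(n,i)$ there exist constants $\kappa_{n,i}<\gamma_{n,i}$ in $[0,1]$ such that $P_{n,i}(\theta)\in[\kappa_{n,i},\gamma_{n,i}]$ for all $\theta$. Moreover, for any $\epsilon>0$ there exist $l_\epsilon,u_\epsilon\in(0,1)$ (not depending on $(n,i)$) such that for all $(n,i)$, $$\sup_{\theta\in[0,l_\epsilon]}[P_{n,i}(\theta)-\kappa_{n,i}]\le\epsilon\quad\text{and}\quad\sup_{\theta\in[u_\epsilon,1]}[\gamma_{n,i}-P_{n,i}(\theta)]\le\epsilon .$$ *)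

theory Defs
  imports "HOL-Probability.Probability"
begin

definition Phi :: "real \<Rightarrow> real" where
  "Phi = cdf std_normal_distribution"

text \<open>Only the values of \<open>Phi_inv\<close> on the range \<open>{0<..<1}\<close> of \<open>Phi\<close> are meaningful.\<close>

definition Phi_inv :: "real \<Rightarrow> real" where
  "Phi_inv = inv Phi"

definition normal_ogive :: "real \<Rightarrow> real \<Rightarrow> real \<Rightarrow> real" where
  "normal_ogive a b x = Phi (a * (x - b))"

text \<open>The response function in terms of the uniform trait. At the endpoints of \<open>{0..1}\<close>, where
  \<open>Phi_inv\<close> is not meaningful, its value is the one-sided limit.\<close>

definition transformed_irf :: "(real \<Rightarrow> real) \<Rightarrow> real \<Rightarrow> real" where
  "transformed_irf q \<theta> =
     (if \<theta> = 0 then Lim (at_right 0) (\<lambda>t. q (Phi_inv t))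
      else if \<theta> = 1 then Lim (at_left 1) (\<lambda>t. q (Phi_inv t))
      else q (Phi_inv \<theta>))"

definition index_set :: "nat \<Rightarrow> (nat \<times> nat) set" where
  "index_set k = {(n, i). k \<le> n \<and> 1 \<le> i \<and> i \<le> n}"

definition condition3 :: "nat \<Rightarrow> (nat \<Rightarrow> nat \<Rightarrow> real \<Rightarrow> real) \<Rightarrow> bool" where
  "condition3 k P \<longleftrightarrow>
     (\<forall>(n, i) \<in> index_set k.
        (\<forall>\<theta>\<in>{0<..<1}. P n i differentiable (at \<theta>)) \<and>
        continuous_on {0<..<1} (deriv (P n i))) \<and>
     (\<forall>\<alpha> \<beta>. 0 < \<alpha> \<and> \<alpha> < \<beta> \<and> \<beta> < 1 \<longrightarrow>
        (\<exists>m M. 0 < m \<and>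
          (\<forall>(n, i) \<in> index_set k. \<forall>\<theta>\<in>{\<alpha>..\<beta>}.
             m < deriv (P n i) \<theta> \<and> deriv (P n i) \<theta> < M)))"

text \<open>The suprema below are taken over nonempty sets, bounded above thanks to the first conjunct.\<close>

definition condition4_with ::
  "nat \<Rightarrow> (nat \<Rightarrow> nat \<Rightarrow> real) \<Rightarrow> (nat \<Rightarrow> nat \<Rightarrow> real) \<Rightarrow> (nat \<Rightarrow> nat \<Rightarrow> real \<Rightarrow> real) \<Rightarrow> bool" where
  "condition4_with k \<kappa> \<gamma> P \<longleftrightarrow>
     (\<forall>(n, i) \<in> index_set k.
        0 \<le> \<kappa> n i \<and> \<kappa> n i < \<gamma> n i \<and> \<gamma> n i \<le> 1 \<and>
        (\<forall>\<theta>\<in>{0..1}. P n i \<theta> \<in> {\<kappa> n i..\<gamma> n i})) \<and>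
     (\<forall>\<epsilon>>0. \<exists>l\<in>{0<..<1}. \<exists>u\<in>{0<..<1}.
        \<forall>(n, i) \<in> index_set k.
          (SUP \<theta>\<in>{0..l}. P n i \<theta> - \<kappa> n i) \<le> \<epsilon> \<and>
          (SUP \<theta>\<in>{u..1}. \<gamma> n i - P n i \<theta>) \<le> \<epsilon>)"

end

theory Submission
  imports Defs "HOL-Real_Asymp.Real_Asymp"
begin

text \<open>With \<open>x = Phi_inv \<theta>\<close>, the chain rule expresses \<open>P' \<theta>\<close> as the quotient
  \<open>a \<phi>(a (x - b)) / \<phi>(x)\<close> of normal densities, which is \<open>a\<close> times the exponential of a polynomial in
  \<open>x\<close> of degree at most two. This polynomial is nonconstant unless \<open>a = 1\<close> and \<open>b = 0\<close>, so it
  diverges as \<open>x \<rightarrow> \<plusminus>\<infinity>\<close>; and it is bounded uniformly when \<open>a\<close>, \<open>b\<close> and \<open>x\<close> range over bounded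
  sets. For Condition 4, the monotonicity of \<open>Phi\<close> lets the extreme values of \<open>a\<close> and \<open>b\<close> control all
  response functions at once.\<close>

section \<open>The normal distribution function\<close>

interpretation std_normal: real_distribution std_normal_distribution
  by (rule real_dist_normal_dist)

lemma std_normal_density_continuous_on: "continuous_on A std_normal_density"
  unfolding std_normal_density_def by (intro continuous_intros) auto

text \<open>\<open>Phi\<close> is given as the distribution function of a measure with a density.
  Writing its increments as interval integrals makes the fundamental theorem of calculus
  applicable.\<close>

lemma Phi_diff:
  assumes "c \<le> x"
  shows "Phi x - Phi c = (LBINT y=c..x. std_normal_density y)"
proof -
  have "Phi x - Phi c = measure std_normal_distribution {c<..x}"
    using assms std_normal.cdf_diff_eq[of c x] by (cases "c = x") (auto simp: Phi_def)
  also have "\<dots> = (\<integral>y. indicator {c<..x} y \<partial>std_normal_distribution)"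
    by simp
  also have "\<dots> = (\<integral>y. std_normal_density y * indicator {c<..x} y \<partial>lborel)"
    by (subst integral_density) auto
  also have "\<dots> = (LBINT y=c..x. std_normal_density y)"
    using assms by (subst interval_integral_Ioc) (auto simp: set_lebesgue_integral_def mult.commute)
  finally show ?thesis .
qed

lemma Phi_has_real_derivative: "(Phi has_real_derivative std_normal_density x) (at x)"
proof -
  \<comment> \<open>The base point \<open>x - 1\<close> is an arbitrary point below
    \<open>x\<close>: it makes the integral start at a finite endpoint and leaves \<open>x\<close>
    in the interior of \<open>{x - 1..x + 1}\<close>, so that the derivative within this interval is
    a two-sided one.\<close>
  let ?F = "\<lambda>u. Phi (x - 1) + (LBINT y=x - 1..u. std_normal_density y)"
  have "((\<lambda>u. LBINT y=x - 1..u. std_normal_density y) has_real_derivative std_normal_density x)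
      (at x within {x - 1..x + 1})"
    unfolding has_real_derivative_iff_has_vector_derivative
    by (intro interval_integral_FTC2 std_normal_density_continuous_on) auto
  then have "((\<lambda>u. LBINT y=x - 1..u. std_normal_density y) has_real_derivative std_normal_density x)
      (at x)"
    by (subst (asm) at_within_interior) auto
  then have "(?F has_real_derivative std_normal_density x) (at x)"
    by (auto intro!: derivative_eq_intros)
  moreover have "\<forall>\<^sub>F u in nhds x. ?F u = Phi u"
  proof -
    have "?F u = Phi u" if "u \<in> {x - 1<..<x + 1}" for u
      using that Phi_diff[of "x - 1" u] by simp
    then show ?thesis
      by (intro eventually_nhds_in_open[THEN eventually_mono, of "{x - 1<..<x + 1}"]) auto
  qed
  ultimately show ?thesis
    by (simp only: DERIV_cong_ev[OF refl _ refl])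
qed

lemma Phi_strict_mono: "strict_mono Phi"
proof (rule strict_monoI)
  fix x y :: real assume "x < y"
  then show "Phi x < Phi y"
    by (rule DERIV_pos_imp_increasing) (use Phi_has_real_derivative normal_density_pos in force)
qed

lemma Phi_less_iff [simp]: "Phi x < Phi y \<longleftrightarrow> x < y"
  using Phi_strict_mono by (rule strict_mono_less)

lemma Phi_le_iff [simp]: "Phi x \<le> Phi y \<longleftrightarrow> x \<le> y"
  using Phi_strict_mono by (rule strict_mono_less_eq)

lemma isCont_Phi: "isCont Phi x"
  using Phi_has_real_derivative by (rule DERIV_isCont)

lemma Phi_at_bot: "(Phi \<longlongrightarrow> 0) at_bot"
  unfolding Phi_def by (rule std_normal.cdf_lim_at_bot)

lemma Phi_at_top: "(Phi \<longlongrightarrow> 1) at_top"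
  unfolding Phi_def by (rule std_normal.cdf_lim_at_top_prob)

text \<open>A distribution function is only nonnegative in general; strict growth from
  \<open>x - 1\<close> to \<open>x\<close> makes the bound strict.\<close>

lemma Phi_pos: "0 < Phi x"
  using Phi_less_iff[of "x - 1" x] std_normal.cdf_nonneg[of "x - 1"] unfolding Phi_def by linarith

lemma Phi_less_1: "Phi x < 1"
  using Phi_less_iff[of x "x + 1"] std_normal.cdf_bounded_prob[of "x + 1"]
  unfolding Phi_def by linarith

section \<open>The inverse of the normal distribution function\<close>

text \<open>The limits 0 and 1 of \<open>Phi\<close> provide points where it lies below and above
  \<theta>; the intermediate value theorem then puts \<theta> in the range of
  \<open>Phi\<close>.\<close>

lemma Phi_Phi_inv:
  assumes "\<theta> \<in> {0<..<1}"
  shows "Phi (Phi_inv \<theta>) = \<theta>"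
proof -
  have "\<forall>\<^sub>F x in at_bot. Phi x < \<theta>" "\<forall>\<^sub>F x in at_top. \<theta> < Phi x"
    using assms order_tendstoD[OF Phi_at_bot] order_tendstoD[OF Phi_at_top] by auto
  then obtain l u where "Phi l < \<theta>" "\<theta> < Phi u"
    using eventually_happens'[OF trivial_limit_at_bot_linorder]
      eventually_happens'[OF trivial_limit_at_top_linorder] by meson
  moreover from this have "l \<le> u"
    using less_trans Phi_less_iff less_imp_le by metis
  ultimately obtain x where "Phi x = \<theta>"
    using IVT[of Phi l \<theta> u] isCont_Phi by auto
  then show ?thesis
    unfolding Phi_inv_def by (metis f_inv_into_f rangeI)
qed

lemma Phi_inv_Phi [simp]: "Phi_inv (Phi x) = x"
  unfolding Phi_inv_def by (rule inv_f_f) (rule strict_mono_imp_inj_on[OF Phi_strict_mono])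

text \<open>Applying the strictly increasing \<open>Phi\<close> to both sides replaces a comparison
  with \<open>Phi_inv\<close> by one in the unit interval. The next three lemmas are
  variants.\<close>

lemma Phi_inv_less_iff: "\<theta> \<in> {0<..<1} \<Longrightarrow> Phi_inv \<theta> < x \<longleftrightarrow> \<theta> < Phi x"
  by (metis Phi_Phi_inv Phi_less_iff)

lemma less_Phi_inv_iff: "\<theta> \<in> {0<..<1} \<Longrightarrow> x < Phi_inv \<theta> \<longleftrightarrow> Phi x < \<theta>"
  by (metis Phi_Phi_inv Phi_less_iff)

lemma Phi_inv_le_iff: "\<theta> \<in> {0<..<1} \<Longrightarrow> Phi_inv \<theta> \<le> x \<longleftrightarrow> \<theta> \<le> Phi x"
  by (metis Phi_Phi_inv Phi_le_iff)

lemma le_Phi_inv_iff: "\<theta> \<in> {0<..<1} \<Longrightarrow> x \<le> Phi_inv \<theta> \<longleftrightarrow> Phi x \<le> \<theta>"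
  by (metis Phi_Phi_inv Phi_le_iff)

lemma isCont_Phi_inv:
  assumes "\<theta> \<in> {0<..<1}"
  shows "isCont Phi_inv \<theta>"
proof -
  have "isCont Phi_inv (Phi (Phi_inv \<theta>))"
    \<comment> \<open>The 1 is the radius of a neighbourhood on which \<open>Phi\<close> is
      continuous and is inverted by \<open>Phi_inv\<close>. Both hold everywhere, so the choice is
      arbitrary.\<close>
    by (rule isCont_inverse_function[of 1]) (auto simp: isCont_Phi)
  then show ?thesis
    using assms by (simp add: Phi_Phi_inv)
qed

lemma Phi_inv_has_real_derivative:
  assumes "\<theta> \<in> {0<..<1}"
  shows "(Phi_inv has_real_derivative inverse (std_normal_density (Phi_inv \<theta>))) (at \<theta>)"
  using assms
  by (intro DERIV_inverse_function[where f = Phi and a = 0 and b = 1]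
        Phi_has_real_derivative isCont_Phi_inv Phi_Phi_inv)
     (auto simp: normal_density_pos less_imp_neq[symmetric])

text \<open>The threshold for a given bound \<open>z\<close> is \<open>Phi z\<close>: positive, and
  \<open>Phi_inv\<close> stays below \<open>z\<close> to the left of it.\<close>

lemma Phi_inv_at_right_0: "filterlim Phi_inv at_bot (at_right 0)"
  unfolding filterlim_at_bot_dense
proof
  fix z
  have "Phi_inv \<theta> < z" if "0 < \<theta>" "\<theta> < Phi z" for \<theta>
    using that Phi_less_1[of z] by (subst Phi_inv_less_iff) auto
  then show "\<forall>\<^sub>F \<theta> in at_right 0. Phi_inv \<theta> < z"
    using Phi_pos by (auto simp: eventually_at_right_field)
qed

lemma Phi_inv_at_left_1: "filterlim Phi_inv at_top (at_left 1)"
  unfolding filterlim_at_top_dense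
proof
  fix z
  have "z < Phi_inv \<theta>" if "Phi z < \<theta>" "\<theta> < 1" for \<theta>
    using that Phi_pos[of z] by (subst less_Phi_inv_iff) auto
  then show "\<forall>\<^sub>F \<theta> in at_left 1. z < Phi_inv \<theta>"
    using Phi_less_1 by (auto simp: eventually_at_left_field)
qed

section \<open>The uniform law of the transformed trait\<close>

text \<open>Probability integral transform: for \<open>t\<close> inside the unit interval,
  \<open>Phi (X \<omega>) \<le> t\<close> is the event that \<open>X \<omega>\<close> is at most
  \<open>Phi_inv t\<close>, which has probability \<open>Phi (Phi_inv t)\<close>.\<close>

lemma (in prob_space) distributed_Phi_uniform:
  assumes X: "distributed M lborel X std_normal_density"
  shows "distributed M lborel (\<lambda>\<omega>. Phi (X \<omega>))
    (\<lambda>x. indicator {0..1} x / measure lborel {0..1::real})"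
proof (rule uniform_distrI_borel_atLeastAtMost)
  have X_meas [measurable]: "X \<in> borel_measurable M"
    using distributed_measurable[OF X] by simp
  have "Phi \<in> borel_measurable borel"
    using isCont_Phi by (intro borel_measurable_continuous_onI continuous_at_imp_continuous_on) auto
  then show "(\<lambda>\<omega>. Phi (X \<omega>)) \<in> borel_measurable M"
    by measurable
  fix t :: real assume t: "0 \<le> t" "t \<le> 1"
  \<comment> \<open>At 0 and 1 \<open>Phi_inv\<close> has no meaning, but there the event is empty
    or the whole space, since \<open>Phi\<close> takes values strictly between 0 and 1.\<close>
  consider "t = 0" | "t \<in> {0<..<1}" | "t = 1"
    using t by fastforce
  then have "prob {\<omega> \<in> space M. Phi (X \<omega>) \<le> t} = t"
  proof cases
    case 1
    then have empty: "{\<omega> \<in> space M. Phi (X \<omega>) \<le> t} = {}"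
      using Phi_pos by (auto simp: not_le)
    show ?thesis
      unfolding empty using 1 by simp
  next
    case 2
    have "prob {\<omega> \<in> space M. Phi (X \<omega>) \<le> t} = prob (X -` {..Phi_inv t} \<inter> space M)"
      using 2 by (intro arg_cong[where f = prob]) (auto simp: le_Phi_inv_iff)
    also have "\<dots> = measure (distr M lborel X) {..Phi_inv t}"
      by (subst measure_distr) auto
    also have "\<dots> = Phi (Phi_inv t)"
      using X by (simp add: distributed_distr_eq_density Phi_def cdf_def)
    finally show ?thesis
      using 2 by (simp add: Phi_Phi_inv)
  next
    case 3
    then show ?thesis
      using Phi_less_1 by (simp add: less_imp_le prob_space)
  qed
  then show "prob {\<omega> \<in> space M. Phi (X \<omega>) \<le> t} = (t - 0) / (1 - 0)"
    by simp
qed simp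

section \<open>Transformed normal ogives\<close>

lemma transformed_irf_eq:
  "\<theta> \<in> {0<..<1} \<Longrightarrow> transformed_irf (normal_ogive a b) \<theta> = Phi (a * (Phi_inv \<theta> - b))"
  by (simp add: transformed_irf_def normal_ogive_def)

text \<open>The value at 0 is a limit by definition. As \<open>a\<close> is positive, the argument
  of \<open>Phi\<close> tends to minus infinity together with \<open>Phi_inv\<close>.\<close>

lemma transformed_irf_0:
  assumes "0 < a"
  shows "transformed_irf (normal_ogive a b) 0 = 0"
proof -
  have "filterlim (\<lambda>x. a * (x - b)) at_bot at_bot"
    using assms by real_asymp
  then have "((\<lambda>t. Phi (a * (Phi_inv t - b))) \<longlongrightarrow> 0) (at_right 0)"
    by (intro filterlim_compose[OF Phi_at_bot] filterlim_compose[OF _ Phi_inv_at_right_0])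
  then show ?thesis
    by (simp add: transformed_irf_def normal_ogive_def tendsto_Lim)
qed

lemma transformed_irf_1:
  assumes "0 < a"
  shows "transformed_irf (normal_ogive a b) 1 = 1"
proof -
  have "filterlim (\<lambda>x. a * (x - b)) at_top at_top"
    using assms by real_asymp
  then have "((\<lambda>t. Phi (a * (Phi_inv t - b))) \<longlongrightarrow> 1) (at_left 1)"
    by (intro filterlim_compose[OF Phi_at_top] filterlim_compose[OF _ Phi_inv_at_left_1])
  then show ?thesis
    by (simp add: transformed_irf_def normal_ogive_def tendsto_Lim)
qed

lemma transformed_irf_bounds:
  assumes "0 < a" "\<theta> \<in> {0..1}"
  shows "transformed_irf (normal_ogive a b) \<theta> \<in> {0..1}"
proof -
  consider "\<theta> = 0" | "\<theta> \<in> {0<..<1}" | "\<theta> = 1"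
    using assms by fastforce
  then show ?thesis
    using assms
    by cases (auto simp: transformed_irf_0 transformed_irf_1 transformed_irf_eq
        intro: less_imp_le Phi_pos Phi_less_1)
qed

section \<open>The derivative as a quotient of normal densities\<close>

text \<open>This is the logarithm of the standard normal density at \<open>a * (x - b)\<close>
  divided by the one at \<open>x\<close>; the normalising constants cancel.\<close>

definition log_density_ratio :: "real \<Rightarrow> real \<Rightarrow> real \<Rightarrow> real" where
  "log_density_ratio a b x = (x\<^sup>2 - (a * (x - b))\<^sup>2) / 2"

lemma std_normal_density_ratio:
  "std_normal_density (a * (x - b)) / std_normal_density x = exp (log_density_ratio a b x)"
  by (simp add: std_normal_density_def log_density_ratio_def diff_divide_distrib exp_diff[symmetric])

lemma transformed_irf_has_real_derivative:
  assumes \<theta>: "\<theta> \<in> {0<..<1}"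
  shows "(transformed_irf (normal_ogive a b) has_real_derivative
    a * exp (log_density_ratio a b (Phi_inv \<theta>))) (at \<theta>)"
proof -
  have "((\<lambda>t. Phi (a * (Phi_inv t - b))) has_real_derivative
      std_normal_density (a * (Phi_inv \<theta> - b)) *
        (a * inverse (std_normal_density (Phi_inv \<theta>)))) (at \<theta>)"
    by (intro DERIV_chain2[OF Phi_has_real_derivative])
       (auto intro!: derivative_eq_intros Phi_inv_has_real_derivative[OF \<theta>])
  then have "((\<lambda>t. Phi (a * (Phi_inv t - b))) has_real_derivative
      a * exp (log_density_ratio a b (Phi_inv \<theta>))) (at \<theta>)"
    by (simp add: std_normal_density_ratio[symmetric] divide_inverse mult_ac)
  \<comment> \<open>The closed formula may fail at the endpoints, but the open unit interval is a
    neighbourhood of \<theta>, and agreement there suffices for the derivative.\<close>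
  moreover have "\<forall>\<^sub>F t in nhds \<theta>.
      transformed_irf (normal_ogive a b) t = Phi (a * (Phi_inv t - b))"
    using eventually_nhds_in_open[of "{0<..<1}" \<theta>] \<theta>
    by (auto elim!: eventually_mono intro: transformed_irf_eq)
  ultimately show ?thesis
    by (simp only: DERIV_cong_ev[OF refl _ refl])
qed

lemmas deriv_transformed_irf = transformed_irf_has_real_derivative[THEN DERIV_imp_deriv]

lemma transformed_irf_differentiable:
  "\<theta> \<in> {0<..<1} \<Longrightarrow> transformed_irf (normal_ogive a b) differentiable (at \<theta>)"
  using transformed_irf_has_real_derivative real_differentiable_def by blast

lemma continuous_on_deriv_transformed_irf:
  "continuous_on {0<..<1} (deriv (transformed_irf (normal_ogive a b)))"
proof -
  have "continuous_on {0<..<1} Phi_inv"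
    by (intro continuous_at_imp_continuous_on ballI isCont_Phi_inv)
  then have "continuous_on {0<..<1} (\<lambda>\<theta>. a * exp (log_density_ratio a b (Phi_inv \<theta>)))"
    unfolding log_density_ratio_def by (intro continuous_intros) auto
  then show ?thesis
    using deriv_transformed_irf by (subst continuous_on_cong[OF refl])
qed

section \<open>Limits of the derivative at the endpoints\<close>

text \<open>A nonconstant polynomial of degree at most two diverges, with the sign of its leading
  coefficient.\<close>

lemma log_density_ratio_at_top:
  assumes "0 < a" "a \<noteq> 1 \<or> b \<noteq> 0"
  shows "filterlim (log_density_ratio a b) at_bot at_top \<or>
    filterlim (log_density_ratio a b) at_top at_top"
proof -
  define c d e where cde: "c = (1 - a\<^sup>2) / 2" "d = a\<^sup>2 * b" "e = - (a\<^sup>2 * b\<^sup>2 / 2)"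
  have eq: "log_density_ratio a b = (\<lambda>x. c * x\<^sup>2 + d * x + e)"
    by (auto simp: log_density_ratio_def cde power2_eq_square field_simps)
  \<comment> \<open>If \<open>c\<close> vanishes, positivity of \<open>a\<close> forces
    \<open>a = 1\<close>; then \<open>b\<close> is nonzero and \<open>d = b\<close>.\<close>
  have "c \<noteq> 0 \<or> d \<noteq> 0"
    using assms by (auto simp: cde power2_eq_1_iff)
  then consider "c < 0" | "c > 0" | "c = 0" "d < 0" | "c = 0" "d > 0"
    by linarith
  then show ?thesis
  proof cases
    case 1
    then have "filterlim (\<lambda>x. c * x\<^sup>2 + d * x + e) at_bot at_top" by real_asymp
    then show ?thesis by (simp add: eq)
  next
    case 2
    then have "filterlim (\<lambda>x. c * x\<^sup>2 + d * x + e) at_top at_top" by real_asymp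
    then show ?thesis by (simp add: eq)
  next
    case 3
    then have "filterlim (\<lambda>x. d * x + e) at_bot at_top" by real_asymp
    with 3 show ?thesis by (simp add: eq)
  next
    case 4
    then have "filterlim (\<lambda>x. d * x + e) at_top at_top" by real_asymp
    with 4 show ?thesis by (simp add: eq)
  qed
qed

text \<open>Reflecting \<open>x\<close> amounts to replacing \<open>b\<close> by \<open>- b\<close>,
  which preserves the assumptions, so this follows from the behaviour at plus infinity.\<close>

lemma log_density_ratio_at_bot:
  assumes "0 < a" "a \<noteq> 1 \<or> b \<noteq> 0"
  shows "filterlim (log_density_ratio a b) at_bot at_bot \<or>
    filterlim (log_density_ratio a b) at_top at_bot"
proof -
  have "log_density_ratio a b (- x) = log_density_ratio a (- b) x" for x
    by (simp add: log_density_ratio_def power2_eq_square algebra_simps)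
  then show ?thesis
    using log_density_ratio_at_top[of a "- b"] assms by (simp add: filterlim_at_bot_mirror)
qed

text \<open>General filters let one argument serve both endpoints: \<open>F\<close> is the approach
  of \<theta> to 0 or 1, and \<open>G\<close> the matching approach of
  \<open>Phi_inv \<theta>\<close> to minus or plus infinity. The exponential turns the two kinds of
  divergence into the limits 0 and plus infinity.\<close>

lemma deriv_transformed_irf_limit:
  assumes a: "0 < a"
    and F: "\<forall>\<^sub>F \<theta> in F. \<theta> \<in> {0<..<1}" "filterlim Phi_inv G F"
    and G: "filterlim (log_density_ratio a b) at_bot G \<or> filterlim (log_density_ratio a b) at_top G"
  shows "(deriv (transformed_irf (normal_ogive a b)) \<longlongrightarrow> 0) F \<or>
    filterlim (deriv (transformed_irf (normal_ogive a b))) at_top F"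
proof -
  have eq: "\<forall>\<^sub>F \<theta> in F. a * exp (log_density_ratio a b (Phi_inv \<theta>)) =
      deriv (transformed_irf (normal_ogive a b)) \<theta>"
    using F(1) by eventually_elim (simp add: deriv_transformed_irf)
  from G show ?thesis
  proof
    assume "filterlim (log_density_ratio a b) at_bot G"
    then have "((\<lambda>\<theta>. a * exp (log_density_ratio a b (Phi_inv \<theta>))) \<longlongrightarrow> a * 0) F"
      by (intro tendsto_mult tendsto_const filterlim_compose[OF exp_at_bot]
          filterlim_compose[OF _ F(2)])
    then show ?thesis
      using Lim_transform_eventually[OF _ eq] by simp
  next
    assume "filterlim (log_density_ratio a b) at_top G"
    then have "filterlim (\<lambda>\<theta>. a * exp (log_density_ratio a b (Phi_inv \<theta>))) at_top F"
      by (intro filterlim_tendsto_pos_mult_at_top[OF tendsto_const a]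
          filterlim_compose[OF exp_at_top] filterlim_compose[OF _ F(2)])
    then show ?thesis
      using filterlim_cong[OF refl refl eq] by simp
  qed
qed

section \<open>Uniform bounds on the derivative: Condition 3\<close>

text \<open>The bound is crude, adding the bounds on both squares; what matters is that it depends
  on \<open>X\<close>, \<open>A\<close> and \<open>B\<close> alone.\<close>

lemma abs_log_density_ratio_le:
  assumes "\<bar>x\<bar> \<le> X" "\<bar>a\<bar> \<le> A" "\<bar>b\<bar> \<le> B"
  shows "\<bar>log_density_ratio a b x\<bar> \<le> X\<^sup>2 + (A * (X + B))\<^sup>2"
proof -
  have "\<bar>a * (x - b)\<bar> \<le> A * (X + B)"
    unfolding abs_mult using assms by (intro mult_mono) auto
  then have "(a * (x - b))\<^sup>2 \<le> (A * (X + B))\<^sup>2" "x\<^sup>2 \<le> X\<^sup>2"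
    using assms by (auto intro!: abs_le_square_iff[THEN iffD1])
  then show ?thesis
    unfolding log_density_ratio_def abs_le_iff
    using zero_le_power2[of x] zero_le_power2[of "a * (x - b)"] by argo
qed

lemma condition3_transformed_irf:
  assumes a_pos: "\<forall>(n, i) \<in> index_set k. 0 < a n i"
    and bounds: "0 < A" "\<forall>(n, i) \<in> index_set k. a n i \<in> {1 / A..A} \<and> \<bar>b n i\<bar> \<le> B"
  shows "condition3 k (\<lambda>n i. transformed_irf (normal_ogive (a n i) (b n i)))"
proof -
  have "\<exists>m M. 0 < m \<and> (\<forall>(n, i) \<in> index_set k. \<forall>\<theta>\<in>{\<alpha>..\<beta>}.
        m < deriv (transformed_irf (normal_ogive (a n i) (b n i))) \<theta> \<and>
        deriv (transformed_irf (normal_ogive (a n i) (b n i))) \<theta> < M)"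
    if \<alpha>\<beta>: "0 < \<alpha>" "\<alpha> < \<beta>" "\<beta> < 1" for \<alpha> \<beta>
  proof -
    \<comment> \<open>Since \<open>Phi_inv\<close> is increasing on the open unit interval, it maps
      \<open>{\<alpha>..\<beta>}\<close> into \<open>{- X..X}\<close>; \<open>E\<close> then bounds
      the exponent for all indices at once.\<close>
    define X where "X = max \<bar>Phi_inv \<alpha>\<bar> \<bar>Phi_inv \<beta>\<bar>"
    define E where "E = X\<^sup>2 + (A * (X + B))\<^sup>2"
    \<comment> \<open>The factors \<open>1 / A\<close> and \<open>A\<close> bound the slopes
      \<open>a n i\<close>; the extra 1 in the exponents makes the inequalities strict.\<close>
    have "1 / A * exp (- E - 1) < deriv (transformed_irf (normal_ogive (a n i) (b n i))) \<theta> \<and>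
        deriv (transformed_irf (normal_ogive (a n i) (b n i))) \<theta> < A * exp (E + 1)"
      if ni: "(n, i) \<in> index_set k" and \<theta>: "\<theta> \<in> {\<alpha>..\<beta>}" for n i \<theta>
    proof -
      have a: "0 < a n i" "1 / A \<le> a n i" "a n i \<le> A" and b: "\<bar>b n i\<bar> \<le> B"
        using a_pos bounds ni by auto
      have "Phi_inv \<alpha> \<le> Phi_inv \<theta>" "Phi_inv \<theta> \<le> Phi_inv \<beta>"
        using \<theta> \<alpha>\<beta> by (auto simp: Phi_inv_le_iff Phi_Phi_inv)
      then have "\<bar>Phi_inv \<theta>\<bar> \<le> X"
        by (auto simp: X_def)
      then have "\<bar>log_density_ratio (a n i) (b n i) (Phi_inv \<theta>)\<bar> \<le> E"
        unfolding E_def using a b by (intro abs_log_density_ratio_le) auto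
      then have "exp (- E - 1) < exp (log_density_ratio (a n i) (b n i) (Phi_inv \<theta>))"
          "exp (log_density_ratio (a n i) (b n i) (Phi_inv \<theta>)) < exp (E + 1)"
        by auto
      then have "1 / A * exp (- E - 1) < a n i * exp (log_density_ratio (a n i) (b n i) (Phi_inv \<theta>))"
          "a n i * exp (log_density_ratio (a n i) (b n i) (Phi_inv \<theta>)) < A * exp (E + 1)"
        using a bounds(1) by (intro mult_le_less_imp_less; simp)+
      then show ?thesis
        using \<theta> \<alpha>\<beta> by (simp add: deriv_transformed_irf)
    qed
    moreover have "0 < 1 / A * exp (- E - 1)"
      using bounds(1) by (intro mult_pos_pos) auto
    ultimately show ?thesis
      by blast
  qed
  then show ?thesis
    unfolding condition3_def
    by (simp add: transformed_irf_differentiable continuous_on_deriv_transformed_irf)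
qed

section \<open>Uniform tail bounds: Condition 4\<close>

text \<open>The threshold \<open>A * y - B\<close> does not involve \<open>a\<close> or
  \<open>b\<close>: subtracting \<open>B\<close> absorbs the shift by \<open>b\<close>, and the
  factor \<open>A\<close> compensates for a small slope.\<close>

lemma transformed_irf_le_lower_tail:
  assumes a: "0 < a" "1 / A \<le> a" and "0 < A" and b: "\<bar>b\<bar> \<le> B" and "y \<le> 0"
    and \<theta>: "\<theta> \<in> {0..Phi (A * y - B)}"
  shows "transformed_irf (normal_ogive a b) \<theta> \<le> Phi y"
proof (cases "\<theta> = 0")
  case True
  then show ?thesis
    using a Phi_pos by (simp add: transformed_irf_0 less_imp_le)
next
  case False
  have \<theta>01: "\<theta> \<in> {0<..<1}"
    using \<theta> False Phi_less_1[of "A * y - B"] by auto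
  have "Phi_inv \<theta> \<le> A * y - B"
    using \<theta> \<theta>01 by (simp add: Phi_inv_le_iff)
  then have "a * (Phi_inv \<theta> - b) \<le> a * (A * y)"
    using a b by (intro mult_left_mono) auto
  also have "\<dots> = (a * A) * y"
    by simp
  \<comment> \<open>Here \<open>a * A\<close> is at least 1, and multiplying by the nonpositive
    \<open>y\<close> reverses the inequality.\<close>
  also have "\<dots> \<le> 1 * y"
    using a \<open>0 < A\<close> \<open>y \<le> 0\<close> by (intro mult_right_mono_neg) (auto simp: field_simps)
  finally show ?thesis
    using \<theta>01 by (simp add: transformed_irf_eq)
qed

text \<open>Mirror image of the lower tail: \<open>B\<close> is now added, and a nonnegative
  \<open>y\<close> keeps the direction of the inequality.\<close>

lemma transformed_irf_ge_upper_tail: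
  assumes a: "0 < a" "1 / A \<le> a" and "0 < A" and b: "\<bar>b\<bar> \<le> B" and "0 \<le> y"
    and \<theta>: "\<theta> \<in> {Phi (A * y + B)..1}"
  shows "Phi y \<le> transformed_irf (normal_ogive a b) \<theta>"
proof (cases "\<theta> = 1")
  case True
  then show ?thesis
    using a Phi_less_1 by (simp add: transformed_irf_1 less_imp_le)
next
  case False
  have \<theta>01: "\<theta> \<in> {0<..<1}"
    using \<theta> False Phi_pos[of "A * y + B"] by auto
  have ge: "A * y + B \<le> Phi_inv \<theta>"
    using \<theta> \<theta>01 by (simp add: le_Phi_inv_iff)
  have "1 * y \<le> (a * A) * y"
    using a \<open>0 < A\<close> \<open>0 \<le> y\<close> by (intro mult_right_mono) (auto simp: field_simps)
  also have "\<dots> = a * (A * y)"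
    by simp
  also have "\<dots> \<le> a * (Phi_inv \<theta> - b)"
    using a b ge by (intro mult_left_mono) auto
  finally show ?thesis
    using \<theta>01 by (simp add: transformed_irf_eq)
qed

lemma condition4_transformed_irf:
  assumes a_pos: "\<forall>(n, i) \<in> index_set k. 0 < a n i"
    and bounds: "0 < A" "\<forall>(n, i) \<in> index_set k. 1 / A \<le> a n i \<and> \<bar>b n i\<bar> \<le> B"
  shows "condition4_with k (\<lambda>n i. 0) (\<lambda>n i. 1)
    (\<lambda>n i. transformed_irf (normal_ogive (a n i) (b n i)))"
proof -
  have "\<exists>l\<in>{0<..<1}. \<exists>u\<in>{0<..<1}. \<forall>(n, i) \<in> index_set k.
      (SUP \<theta>\<in>{0..l}. transformed_irf (normal_ogive (a n i) (b n i)) \<theta> - 0) \<le> \<epsilon> \<and>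
      (SUP \<theta>\<in>{u..1}. 1 - transformed_irf (normal_ogive (a n i) (b n i)) \<theta>) \<le> \<epsilon>"
    if "0 < \<epsilon>" for \<epsilon> :: real
  proof -
    \<comment> \<open>The witnesses will be \<open>Phi (A * y - B)\<close> for \<open>l\<close> and
      \<open>Phi (A * z + B)\<close> for \<open>u\<close>, with \<open>y\<close> and
      \<open>z\<close> so far out that \<open>Phi\<close> is within \<epsilon> of its limits there.
      Their signs are those that the tail bounds require.\<close>
    have "\<forall>\<^sub>F y in at_bot. Phi y < \<epsilon> \<and> y \<le> 0"
      using that order_tendstoD(2)[OF Phi_at_bot] eventually_le_at_bot
      by (auto intro: eventually_conj)
    then obtain y where y: "Phi y < \<epsilon>" "y \<le> 0"
      using eventually_happens'[OF trivial_limit_at_bot_linorder] by blast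
    have "\<forall>\<^sub>F z in at_top. 1 - \<epsilon> < Phi z \<and> 0 \<le> z"
      using that order_tendstoD(1)[OF Phi_at_top, of "1 - \<epsilon>"] eventually_ge_at_top
      by (auto intro: eventually_conj)
    then obtain z where z: "1 - \<epsilon> < Phi z" "0 \<le> z"
      using eventually_happens'[OF trivial_limit_at_top_linorder] by blast
    have "(SUP \<theta>\<in>{0..Phi (A * y - B)}. transformed_irf (normal_ogive (a n i) (b n i)) \<theta> - 0) \<le> \<epsilon> \<and>
        (SUP \<theta>\<in>{Phi (A * z + B)..1}. 1 - transformed_irf (normal_ogive (a n i) (b n i)) \<theta>) \<le> \<epsilon>"
      if ni: "(n, i) \<in> index_set k" for n i
    proof (intro conjI cSUP_least)
      have a: "0 < a n i" "1 / A \<le> a n i" "\<bar>b n i\<bar> \<le> B"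
        using a_pos bounds ni by auto
      show "transformed_irf (normal_ogive (a n i) (b n i)) \<theta> - 0 \<le> \<epsilon>"
        if "\<theta> \<in> {0..Phi (A * y - B)}" for \<theta>
        using transformed_irf_le_lower_tail[of "a n i" A "b n i" B y \<theta>] a bounds(1) y that by linarith
      show "1 - transformed_irf (normal_ogive (a n i) (b n i)) \<theta> \<le> \<epsilon>"
        if "\<theta> \<in> {Phi (A * z + B)..1}" for \<theta>
        using transformed_irf_ge_upper_tail[of "a n i" A "b n i" B z \<theta>] a bounds(1) z that by linarith
    \<comment> \<open>What remains is that both intervals are nonempty, as the bound on a real
      supremum requires.\<close>
    qed (use Phi_pos Phi_less_1 in \<open>auto simp: less_imp_le\<close>)
    moreover have "Phi x \<in> {0<..<1}" for x
      using Phi_pos Phi_less_1 by simp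
    ultimately show ?thesis
      by blast
  qed
  moreover have "\<forall>(n, i) \<in> index_set k. \<forall>\<theta>\<in>{0..1}.
      transformed_irf (normal_ogive (a n i) (b n i)) \<theta> \<in> {0..1}"
    using a_pos transformed_irf_bounds by fastforce
  ultimately show ?thesis
    unfolding condition4_with_def by auto
qed

theorem proposition1:
  fixes k :: nat
    and a b :: "nat \<Rightarrow> nat \<Rightarrow> real"
    and Q P :: "nat \<Rightarrow> nat \<Rightarrow> real \<Rightarrow> real"
    and \<Omega> :: "'w measure"
    and \<Lambda> \<Theta> :: "'w \<Rightarrow> real"
  assumes k: "1 \<le> k"
    and a_pos: "\<forall>(n, i) \<in> index_set k. 0 < a n i"
    and Q: "\<And>n i. Q n i = normal_ogive (a n i) (b n i)"
    and P: "\<And>n i. P n i = transformed_irf (Q n i)"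
    and \<Omega>: "prob_space \<Omega>"
    and \<Lambda>: "distributed \<Omega> lborel \<Lambda> std_normal_density"
    and \<Theta>: "\<And>\<omega>. \<Theta> \<omega> = Phi (\<Lambda> \<omega>)"
  shows "distributed \<Omega> lborel \<Theta> (\<lambda>x. indicator {0..1} x / measure lborel {0..1::real}) \<and>
         (\<forall>(n, i) \<in> index_set k. \<bar>a n i\<bar> \<noteq> 1 \<or> b n i \<noteq> 0 \<longrightarrow>
           (\<forall>\<theta>\<in>{0<..<1}. P n i differentiable (at \<theta>)) \<and>
           ((deriv (P n i) \<longlongrightarrow> 0) (at_right 0) \<or>
            filterlim (deriv (P n i)) at_top (at_right 0)) \<and>
           ((deriv (P n i) \<longlongrightarrow> 0) (at_left 1) \<or>
            filterlim (deriv (P n i)) at_top (at_left 1))) \<and>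
         ((\<exists>C\<^sub>a>0. \<exists>C\<^sub>b>0. \<forall>(n, i) \<in> index_set k.
            a n i \<in> {1 / C\<^sub>a..C\<^sub>a} \<and> \<bar>b n i\<bar> \<in> {1 / C\<^sub>b..C\<^sub>b}) \<longrightarrow>
         condition3 k P \<and> condition4_with k (\<lambda>n i. 0) (\<lambda>n i. 1) P)"
proof -
  have P_eq: "P = (\<lambda>n i. transformed_irf (normal_ogive (a n i) (b n i)))"
    by (intro ext) (simp only: P Q)
  have "\<Theta> = (\<lambda>\<omega>. Phi (\<Lambda> \<omega>))"
    by (intro ext) (rule \<Theta>)
  then have uniform: "distributed \<Omega> lborel \<Theta> (\<lambda>x. indicator {0..1} x / measure lborel {0..1::real})"
    using prob_space.distributed_Phi_uniform[OF \<Omega> \<Lambda>] by simp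
  have near_0: "\<forall>\<^sub>F \<theta> in at_right 0. \<theta> \<in> {0<..<1::real}"
    using eventually_at_right_real[of 0 "1::real"] by simp
  have near_1: "\<forall>\<^sub>F \<theta> in at_left 1. \<theta> \<in> {0<..<1::real}"
    using eventually_at_left_real[of 0 "1::real"] by simp
  have limits: "(\<forall>\<theta>\<in>{0<..<1}. P n i differentiable (at \<theta>)) \<and>
      ((deriv (P n i) \<longlongrightarrow> 0) (at_right 0) \<or> filterlim (deriv (P n i)) at_top (at_right 0)) \<and>
      ((deriv (P n i) \<longlongrightarrow> 0) (at_left 1) \<or> filterlim (deriv (P n i)) at_top (at_left 1))"
    if "(n, i) \<in> index_set k" "\<bar>a n i\<bar> \<noteq> 1 \<or> b n i \<noteq> 0" for n i
  proof -
    \<comment> \<open>Positivity of \<open>a n i\<close> removes the absolute value.\<close>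
    have a: "0 < a n i" "a n i \<noteq> 1 \<or> b n i \<noteq> 0"
      using that a_pos by auto
    show ?thesis
      unfolding P_eq
      by (intro conjI ballI transformed_irf_differentiable
          deriv_transformed_irf_limit[OF a(1) near_0 Phi_inv_at_right_0 log_density_ratio_at_bot[OF a]]
          deriv_transformed_irf_limit[OF a(1) near_1 Phi_inv_at_left_1 log_density_ratio_at_top[OF a]])
  qed
  have conditions: "condition3 k P \<and> condition4_with k (\<lambda>n i. 0) (\<lambda>n i. 1) P"
    if "0 < A" "\<forall>(n, i) \<in> index_set k. a n i \<in> {1 / A..A} \<and> \<bar>b n i\<bar> \<in> {1 / B..B}" for A B
    unfolding P_eq
    by (intro conjI condition3_transformed_irf[of k a A b B]
        condition4_transformed_irf[of k a A b B]) (use a_pos that in auto)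
  show ?thesis
    using uniform limits conditions by blast
qed

end
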